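(* $N_2(8)\ge 426$ and $R_2(8)\ge .5434$.
   Context: All invertibility is over $\mathbb{F}_2$. For an $s\times s$ invertible $0$-$1$ matrix $M$, $N_2(M)$ is the number of invertible $2\times2$ submatrices of $M$ (one for each choice of two rows and two columns), and $R_2(M)=N_2(M)/\binom{s}{2}^2$. $N_2(s)$ and $R_2(s)$ denote the maxima of $N_2(M)$ and $R_2(M)$, respectively, over all $s\times s$ invertible $0$-$1$ matrices $M$. *)

theory Defs
  imports
    "HOL-Library.Z2"
    "HOL-Library.FuncSet"
    "Jordan_Normal_Form.DL_Submatrix"
begin

text \<open>
  The field with two elements is the type \<^typ>\<open>bit\<close>, so a 0-1 matrix, regarded over
  that field, is a \<^typ>\<open>bit mat\<close>; rows and columns are indexed from 0.
\<close>

definition invertible_mats :: "nat \<Rightarrow> bit mat set" where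
  "invertible_mats s = {M \<in> carrier_mat s s. invertible_mat M}"

definition N2_mat :: "bit mat \<Rightarrow> nat" where
  "N2_mat M = card {(I, J). I \<subseteq> {..<dim_row M} \<and> card I = 2 \<and>
                            J \<subseteq> {..<dim_col M} \<and> card J = 2 \<and>
                            invertible_mat (submatrix M I J)}"

text \<open>
  Only meant for square matrices, whose common number of rows and columns is
  \<^term>\<open>dim_row M\<close>.
\<close>

definition R2_mat :: "bit mat \<Rightarrow> real" where
  "R2_mat M = real (N2_mat M) / (real (dim_row M choose 2))\<^sup>2"

definition N2 :: "nat \<Rightarrow> nat" where
  "N2 s = Max (N2_mat ` invertible_mats s)"

definition R2 :: "nat \<Rightarrow> real" where
  "R2 s = Max (R2_mat ` invertible_mats s)"

text \<open>The two maxima range over finite nonempty sets, so they are attained.\<close>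

lemma finite_invertible_mats: "finite (invertible_mats s)"
proof (rule finite_subset)
  let ?F = "({..<s} \<times> {..<s}) \<rightarrow>\<^sub>E (UNIV :: bit set)"
  show "invertible_mats s \<subseteq> mat s s ` ?F"
  proof
    fix M assume "M \<in> invertible_mats s"
    then have "M \<in> carrier_mat s s"
      by (simp add: invertible_mats_def)
    then have "M = mat s s (restrict (\<lambda>ij. M $$ ij) ({..<s} \<times> {..<s}))"
      by (intro eq_matI) auto
    then show "M \<in> mat s s ` ?F"
      by (rule image_eqI[where x = "restrict (($$) M) ({..<s} \<times> {..<s})"]) auto
  qed
  have "(UNIV :: bit set) = {0, 1}"
    using bit_not_zero_iff by auto
  then have "finite (UNIV :: bit set)"
    by (metis finite.emptyI finite.insertI)
  then show "finite (mat s s ` ?F)"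
    by (intro finite_imageI finite_PiE) auto
qed

lemma invertible_mats_nonempty: "invertible_mats s \<noteq> {}"
proof -
  have "1\<^sub>m s \<in> invertible_mats s"
    unfolding invertible_mats_def invertible_mat_def inverts_mat_def square_mat.simps
    by (auto intro!: exI[of _ "1\<^sub>m s"])
  then show ?thesis by blast
qed

end

(*
  Take the circulant matrix C with ones in the positions (i, i + k), k in {0, 1, 2, 5, 6}, indices
  mod 8. It is p(P) for the cyclic shift P and p = 1 + x + x^2 + x^5 + x^6, and squaring is additive
  over the field with two elements, so C^2 = p(P^2) = 1 + P^2 + P^4 + P^10 + P^12 = 1. Hence C is
  its own inverse. It has 460 invertible 2x2 submatrices, and 460/784 > 0.5434 (whereas 426/784
  itself lies slightly below 0.5434).
*)
theory Submission
  imports Defs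
begin

text \<open>The adjugate \<open>B\<close> is a two-sided inverse when the determinant is 1.\<close>

lemma invertible_mat_2:
  fixes A :: "'a :: comm_ring_1 mat"
  assumes A: "A \<in> carrier_mat 2 2"
    and det: "A $$ (0,0) * A $$ (1,1) - A $$ (0,1) * A $$ (1,0) = 1"
  shows "invertible_mat A"
proof -
  define B where "B = mat 2 2 (\<lambda>(i,j). if i = j then A $$ (1-i,1-j) else - A $$ (i,j))"
  have "A * B = 1\<^sub>m 2"
    using A det by (intro eq_matI)
      (auto simp: B_def less_Suc_eq scalar_prod_def numeral_2_eq_2 algebra_simps)
  moreover have "B * A = 1\<^sub>m 2"
    using A det by (intro eq_matI)
      (auto simp: B_def less_Suc_eq scalar_prod_def numeral_2_eq_2 algebra_simps)
  ultimately show ?thesis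
    using A unfolding invertible_mat_def inverts_mat_def square_mat.simps
    by (auto intro!: exI[of _ B] simp: B_def)
qed

lemma pick_doubleton:
  assumes "a < b"
  shows "pick {a, b} 0 = a" "pick {a, b} (Suc 0) = b"
proof -
  show *: "pick {a, b} 0 = a"
    using assms by (auto intro!: Least_equality)
  show "pick {a, b} (Suc 0) = b"
    using assms * by (auto intro!: Least_equality)
qed

lemma invertible_submatrix_2:
  fixes M :: "bit mat"
  assumes "a < b" "b < dim_row M" "c < d" "d < dim_col M"
    and det: "M $$ (a,c) * M $$ (b,d) \<noteq> M $$ (a,d) * M $$ (b,c)"
  shows "invertible_mat (submatrix M {a, b} {c, d})"
proof (rule invertible_mat_2)
  have rows: "{i. i < dim_row M \<and> i \<in> {a, b}} = {a, b}"
    and cols: "{j. j < dim_col M \<and> j \<in> {c, d}} = {c, d}"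
    using assms by auto
  show "submatrix M {a, b} {c, d} \<in> carrier_mat 2 2"
    using assms(1,3) unfolding submatrix_def rows cols by (simp add: numeral_2_eq_2)
  \<comment> \<open>A nonzero determinant over the field with two elements equals 1, as the adjugate
    criterion demands.\<close>
  have "M $$ (a,c) * M $$ (b,d) - M $$ (a,d) * M $$ (b,c) = 1"
    using det by (metis bit_not_zero_iff eq_iff_diff_eq_0)
  then show "submatrix M {a, b} {c, d} $$ (0,0) * submatrix M {a, b} {c, d} $$ (1,1)
      - submatrix M {a, b} {c, d} $$ (0,1) * submatrix M {a, b} {c, d} $$ (1,0) = 1"
    using assms(1-4) unfolding submatrix_def rows cols by (simp add: pick_doubleton del: pick.simps)
qed

text \<open>Replaces subsets and \<open>submatrix\<close> by increasing index pairs and 2x2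
  determinants, which can be counted by evaluation. The order makes \<open>(a, b)\<close>
  recoverable from \<open>{a, b}\<close>, hence the injection; one inequality suffices for a lower
  bound.\<close>

lemma card_minors_le_N2_mat:
  "card {((a, b), (c, d)). a < b \<and> b < dim_row M \<and> c < d \<and> d < dim_col M \<and>
      M $$ (a,c) * M $$ (b,d) \<noteq> M $$ (a,d) * M $$ (b,c)} \<le> N2_mat M"
    (is "card ?S \<le> _")
  unfolding N2_mat_def
proof (rule card_inj_on_le)
  let ?f = "\<lambda>((a :: nat, b :: nat), (c :: nat, d :: nat)). ({a, b}, {c, d})"
  let ?T = "{(I, J). I \<subseteq> {..<dim_row M} \<and> card I = 2 \<and> J \<subseteq> {..<dim_col M} \<and> card J = 2 \<and>
    invertible_mat (submatrix M I J)}"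
  show "inj_on ?f ?S"
    by (auto simp: inj_on_def doubleton_eq_iff)
  show "?f ` ?S \<subseteq> ?T"
    using invertible_submatrix_2[of _ _ M] by auto
  show "finite ?T"
    by (rule finite_subset[of _ "Pow {..<dim_row M} \<times> Pow {..<dim_col M}"]) auto
qed

text \<open>The summand 8 keeps the natural-number subtraction from truncating, so the term is the
  residue of j - i mod 8.\<close>

definition circ :: "bit mat" where
  "circ = mat 8 8 (\<lambda>(i,j). of_bool ((j + 8 - i) mod 8 \<in> {0,1,2,5,6}))"

lemma less_8_cases: "(i :: nat) < 8 \<longleftrightarrow> i \<in> {0,1,2,3,4,5,6,7}"
  by auto

lemma circ_in_invertible_mats: "circ \<in> invertible_mats 8"
proof -
  have "circ * circ = 1\<^sub>m 8"
  proof (rule eq_matI)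
    fix i j assume "i < dim_row (1\<^sub>m 8 :: bit mat)" "j < dim_col (1\<^sub>m 8 :: bit mat)"
    then have ij: "i < 8" "j < 8"
      by simp_all
    then have "(circ * circ) $$ (i,j) = (\<Sum>k\<in>{0..<8}. of_bool ((k + 8 - i) mod 8 \<in> {0,1,2,5,6}) *
        of_bool ((j + 8 - k) mod 8 \<in> {0,1,2,5,6}))"
      by (simp add: circ_def scalar_prod_def)
    \<comment> \<open>With the index set enumerated, each of the 64 cases for \<open>(i, j)\<close>
      is a sum of eight concrete terms.\<close>
    also have "{0..<8} = {0,1,2,3,4,5,6,7::nat}"
      by auto
    also have "(\<Sum>k\<in>\<dots>. of_bool ((k + 8 - i) mod 8 \<in> {0,1,2,5,6}) *
        of_bool ((j + 8 - k) mod 8 \<in> {0,1,2,5,6})) = (of_bool (i = j) :: bit)"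
      using ij unfolding less_8_cases by (elim insertE emptyE; hypsubst; simp)
    finally show "(circ * circ) $$ (i,j) = 1\<^sub>m 8 $$ (i,j)"
      using ij by simp
  qed (simp_all add: circ_def)
  then show ?thesis
    unfolding invertible_mats_def invertible_mat_def inverts_mat_def square_mat.simps
    by (auto intro!: exI[of _ circ] simp: circ_def)
qed

lemma N2_mat_circ: "460 \<le> N2_mat circ"
proof -
  define P where "P = (SIGMA a:{0..<8}. {Suc a..<8})"
  have sum_P: "sum f P = (\<Sum>a = 0..<8. \<Sum>b = Suc a..<8. f (a, b))" for f :: "nat \<times> nat \<Rightarrow> nat"
    by (simp add: P_def sum.Sigma split_def)
  \<comment> \<open>A Boolean copy of the entries keeps matrices and \<open>bit\<close> arithmetic
    out of the evaluation; products become conjunctions in \<open>Q\<close>.\<close>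
  define E :: "nat \<Rightarrow> nat \<Rightarrow> bool" where "E = (\<lambda>i j. (j + 8 - i) mod 8 \<in> {0,1,2,5,6})"
  have E: "circ $$ (i,j) = of_bool (E i j)" if "i < 8" "j < 8" for i j
    using that by (simp add: circ_def E_def)
  define Q where "Q = (\<lambda>((a, b), (c, d)). (E a c \<and> E b d) \<noteq> (E a d \<and> E b c))"
  \<comment> \<open>Evaluates \<open>Q\<close> on all 28 * 28 = 784 choices of two rows and two
    columns.\<close>
  have "(460::nat) = (\<Sum>a = 0..<8. \<Sum>b = Suc a..<8. \<Sum>c = 0..<8. \<Sum>d = Suc c..<8.
      if Q ((a, b), (c, d)) then 1 else 0)"
    unfolding Q_def E_def by code_simp
  also have "\<dots> = (\<Sum>x\<in>P \<times> P. if Q x then 1 else 0)"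
    by (simp only: sum_P sum.cartesian_product')
  also have "\<dots> = card {x \<in> P \<times> P. Q x}"
    by (simp add: P_def sum.If_cases Int_def)
  also have "{x \<in> P \<times> P. Q x} = {((a, b), (c, d)). a < b \<and> b < dim_row circ \<and> c < d \<and>
      d < dim_col circ \<and> circ $$ (a,c) * circ $$ (b,d) \<noteq> circ $$ (a,d) * circ $$ (b,c)}"
    \<comment> \<open>Only the dimensions of \<open>circ\<close> are unfolded, so that its entries
      are still rewritten by \<open>E\<close>.\<close>
    by (auto simp: P_def Q_def E circ_def[THEN arg_cong, of dim_row]
        circ_def[THEN arg_cong, of dim_col])
  also have "card \<dots> \<le> N2_mat circ"
    by (rule card_minors_le_N2_mat)
  finally show ?thesis .
qed

theorem theorem5p1:
  shows "N2 8 \<ge> 426 \<and> R2 8 \<ge> 0.5434"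
proof
  have "N2_mat circ \<le> N2 8"
    unfolding N2_def by (simp add: finite_invertible_mats circ_in_invertible_mats)
  then show "N2 8 \<ge> 426"
    using N2_mat_circ by linarith
  have "8 choose 2 = (28 :: nat)"
    by (simp add: choose_two)
  moreover have "dim_row circ = 8"
    by (simp add: circ_def)
  ultimately have "(0.5434 :: real) \<le> R2_mat circ"
    using N2_mat_circ by (simp add: R2_mat_def)
  also have "\<dots> \<le> R2 8"
    unfolding R2_def by (simp add: finite_invertible_mats circ_in_invertible_mats)
  finally show "R2 8 \<ge> 0.5434" .
qed

end
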